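(* Let $\alpha\in\left(\frac{-1}{n-1},1\right)$ and $S\in EM^n_\alpha$. Then one can obtain from $S$ a doubly equiangular matrix $\bar S\in DEM^n_\alpha$ (respectively, when $\alpha=0$, a doubly orthogonal matrix $\bar S\in DOM^n$) as follows: $$\bar S=\left(I-\frac{2uu^T}{\Vert u\Vert^2}\right)S,\qquad\text{where}\quad u=\left(S-\sqrt{1+(n-1)\alpha}\;I\right)e.$$
   Context: $e=[1,\dots,1]^T\in\mathbb{R}^n$, $I$ is the $n\times n$ identity matrix and $\Vert\cdot\Vert$ is the Euclidean norm. For $\alpha\in\left(\frac{-1}{n-1},1\right)$, $EM^n_\alpha$ denotes the set of nonsingular real $n\times n$ matrices $S=[s_1,\dots,s_n]$ whose columns satisfy $s_i^Ts_i=1$ and $s_i^Ts_j=\alpha$ for $i\ne j$ (for $\alpha=0$, the orthogonal matrices). For nonzero $\alpha\in\left(\frac{-1}{n-1},1\right)$, $DEM^n_\alpha$ (doubly equiangular matrices) is the set of matrices $\bar S$ such that both $\bar S\in EM^n_\alpha$ and $\bar S^T\in EM^n_\alpha$. $DOM^n$ (doubly orthogonal matrices) is the set of real orthogonal $n\times n$ matrices having $e$ as an eigenvector. *)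

theory Defs
  imports "HOL-Analysis.Analysis"
begin

definition ones :: "real^'n" where
  "ones = (\<chi> i. 1)"

text \<open>The range of \<open>\<alpha>\<close> (the open interval from \<open>-1/(n-1)\<close> to \<open>1\<close>) is not built into the following
  sets; it has to be assumed where they are used.\<close>

definition equiangular_matrices :: "real \<Rightarrow> (real^'n^'n) set" where
  "equiangular_matrices \<alpha> =
    {S. invertible S \<and> (\<forall>i. column i S \<bullet> column i S = 1) \<and>
        (\<forall>i j. i \<noteq> j \<longrightarrow> column i S \<bullet> column j S = \<alpha>)}"

text \<open>Only meant for \<open>\<alpha> \<noteq> 0\<close>: at \<open>\<alpha> = 0\<close> this would be the set of all orthogonal matrices,
  and the set \<open>doubly_orthogonal_matrices\<close> takes its place.\<close>

definition doubly_equiangular_matrices :: "real \<Rightarrow> (real^'n^'n) set" where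
  "doubly_equiangular_matrices \<alpha> =
    {S. S \<in> equiangular_matrices \<alpha> \<and> transpose S \<in> equiangular_matrices \<alpha>}"

definition is_eigenvector :: "real^'n^'n \<Rightarrow> real^'n \<Rightarrow> bool" where
  "is_eigenvector A v \<longleftrightarrow> v \<noteq> 0 \<and> (\<exists>c. A *v v = c *\<^sub>R v)"

definition doubly_orthogonal_matrices :: "(real^'n^'n) set" where
  "doubly_orthogonal_matrices = {S. orthogonal_matrix S \<and> is_eigenvector S ones}"

text \<open>\<open>I - 2 u u\<^sup>T / \<parallel>u\<parallel>\<^sup>2\<close>, with \<open>u u\<^sup>T\<close> the product of an \<open>n \<times> 1\<close> and a \<open>1 \<times> n\<close> matrix. For
  \<open>u = 0\<close>, where the quotient is undefined on paper, this is \<open>I\<close>.\<close>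

definition householder :: "real^'n \<Rightarrow> real^'n^'n" where
  "householder u =
    mat 1 - (2 / (norm u)\<^sup>2) *\<^sub>R ((columnvector u :: real^1^'n) ** (rowvector u :: real^'n^1))"

end

theory Submission
  imports Defs
begin

text \<open>
  Put \<open>c = sqrt (1 + (n - 1) \<alpha>)\<close> and let \<open>G\<close> be the Gram matrix with diagonal \<open>1\<close> and off-diagonal
  \<open>\<alpha>\<close>. Since \<open>S e\<close> and \<open>c e\<close> have the same norm, the reflection along \<open>u = S e - c e\<close> maps \<open>S e\<close> to
  \<open>c e\<close>, so \<open>S' e = c e\<close>, and it preserves \<open>S'\<^sup>T S' = G\<close>. From \<open>G e = c\<^sup>2 e\<close> also \<open>S'\<^sup>T e = c e\<close>, so \<open>S'\<close>
  commutes with \<open>G = (1 - \<alpha>) I + \<alpha> e e\<^sup>T\<close>. Hence \<open>S' S'\<^sup>T S' = S' G = G S'\<close>, and cancelling \<open>S'\<close> gives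
  \<open>S' S'\<^sup>T = G\<close>.
\<close>

definition equiangular_gram :: "real \<Rightarrow> real^'n^'n" where
  "equiangular_gram \<alpha> = (\<chi> i j. if i = j then 1 else \<alpha>)"

lemma equiangular_matrices_iff:
  "S \<in> equiangular_matrices \<alpha> \<longleftrightarrow> invertible S \<and> transpose S ** S = equiangular_gram \<alpha>"
  by (auto simp: equiangular_matrices_def equiangular_gram_def matrix_mult_transpose_dot_column
      vec_eq_iff)

lemma equiangular_gram_0: "equiangular_gram 0 = mat 1"
  by (simp add: equiangular_gram_def mat_def)

text \<open>Applied form of the decomposition
  \<open>(1 - \<alpha>) I + \<alpha> e e\<^sup>T\<close>, which reduces commuting with the Gram
  matrix to the action on \<open>ones\<close> and on sums of entries.\<close>

lemma equiangular_gram_mult_vec: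
  fixes x :: "real^'n"
  shows "equiangular_gram \<alpha> *v x = (1 - \<alpha>) *\<^sub>R x + (\<alpha> * (ones \<bullet> x)) *\<^sub>R ones"
proof (simp add: vec_eq_iff, intro allI)
  fix i
  have "(equiangular_gram \<alpha> *v x) $ i = (\<Sum>j\<in>UNIV. (if j = i then (1 - \<alpha>) * x $ j else 0) + \<alpha> * x $ j)"
    unfolding matrix_vector_mult_def equiangular_gram_def
    by (auto intro!: sum.cong simp: algebra_simps)
  also have "\<dots> = (1 - \<alpha>) * x $ i + \<alpha> * (\<Sum>j\<in>UNIV. x $ j)"
    by (simp add: sum.distrib sum_distrib_left)
  finally show "(equiangular_gram \<alpha> *v x) $ i = (1 - \<alpha>) * x $ i + \<alpha> * (ones \<bullet> x) * ones $ i"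
    by (simp add: ones_def inner_vec_def)
qed

lemma inner_ones_ones: "(ones :: real^'n) \<bullet> ones = real CARD('n)"
  by (simp add: ones_def inner_vec_def)

lemma equiangular_gram_mult_ones:
  "equiangular_gram \<alpha> *v (ones :: real^'n) = (1 + (real CARD('n) - 1) * \<alpha>) *\<^sub>R ones"
  by (simp add: equiangular_gram_mult_vec inner_ones_ones flip: scaleR_add_left)
    (simp add: algebra_simps)

text \<open>The rank-one product sends \<open>x\<close> to
  \<open>(u \<bullet> x) *\<^sub>R u\<close>. For \<open>u = 0\<close> both sides are
  \<open>x\<close>.\<close>

lemma householder_mult_vec:
  "householder u *v x = x - (2 * (u \<bullet> x) / (norm u)\<^sup>2) *\<^sub>R u"
  by (simp add: householder_def vec_eq_iff matrix_vector_mult_diff_rdistrib scaleR_matrix_vector_assoc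
      [symmetric] matrix_vector_mul_assoc[symmetric])
    (simp add: matrix_vector_mult_def columnvector_def rowvector_def inner_vec_def)

text \<open>For nonzero \<open>u\<close> the two cross terms contribute
  \<open>-4 (u \<bullet> x) (u \<bullet> y) / (u \<bullet> u)\<close>, which the quadratic term
  cancels.\<close>

lemma householder_inner:
  "(householder u *v x) \<bullet> (householder u *v y) = x \<bullet> y"
proof (cases "u = 0")
  case False
  then have "u \<bullet> u \<noteq> 0" by simp
  then show ?thesis
    by (simp add: householder_mult_vec inner_diff_left inner_diff_right power2_norm_eq_inner
        inner_commute[of x u] field_simps)
qed (simp add: householder_mult_vec)

lemma orthogonal_matrix_householder: "orthogonal_matrix (householder u)"
proof -
  have "orthogonal_transformation ((*v) (householder u))"
    by (simp add: orthogonal_transformation_def householder_inner)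
  then show ?thesis
    by (simp add: orthogonal_transformation_matrix)
qed

text \<open>Equal norms make the coefficient of \<open>x - y\<close> in the reflection exactly
  \<open>1\<close>, so \<open>x - (x - y)\<close> remains. If \<open>x = y\<close>, the reflection
  is the identity.\<close>

lemma householder_swap:
  assumes "norm x = norm y"
  shows "householder (x - y) *v x = y"
proof (cases "x = y")
  case False
  have "(norm (x - y))\<^sup>2 = 2 * ((x - y) \<bullet> x)"
    using assms by (simp add: power2_norm_eq_inner norm_eq inner_diff_left inner_diff_right inner_commute)
  moreover have "norm (x - y) \<noteq> 0"
    using False by simp
  ultimately have "2 * ((x - y) \<bullet> x) / (norm (x - y))\<^sup>2 = 1"
    by (metis div_self power_not_zero)
  then show ?thesis
    by (simp only: householder_mult_vec) simp
qed (simp add: householder_mult_vec)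

text \<open>The factor \<open>transpose Q ** Q\<close> cancels inside the Gram matrix.\<close>

lemma orthogonal_mult_equiangular:
  assumes "orthogonal_matrix Q" and "S \<in> equiangular_matrices \<alpha>"
  shows "Q ** S \<in> equiangular_matrices \<alpha>"
proof -
  have "transpose (Q ** S) ** (Q ** S) = transpose S ** (transpose Q ** Q) ** S"
    by (simp only: matrix_transpose_mul matrix_mul_assoc)
  then show ?thesis
    using assms unfolding equiangular_matrices_iff orthogonal_matrix_def
    by (metis invertible_def invertible_mult matrix_mul_rid)
qed

lemma transpose_equiangular_if_eigenvector_ones:
  assumes T: "T \<in> equiangular_matrices \<alpha>" and e: "T *v ones = c *\<^sub>R ones" and "c \<noteq> 0"
  shows "transpose T \<in> equiangular_matrices \<alpha>"
proof -
  \<comment> \<open>Here \<open>n\<close> is the eigenvalue of the Gram matrix at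
    \<open>ones\<close>, not the dimension.\<close>
  define n where "n = 1 + (real CARD('a) - 1) * \<alpha>"
  have inv: "invertible T" and gram: "transpose T ** T = equiangular_gram \<alpha>"
    using T by (simp_all add: equiangular_matrices_iff)
  have "c *\<^sub>R (transpose T *v ones) = transpose T *v (T *v ones)"
    by (simp add: e matrix_vector_mult_scaleR)
  also have "\<dots> = n *\<^sub>R ones"
    by (simp only: matrix_vector_mul_assoc gram equiangular_gram_mult_ones n_def)
  finally have te: "c *\<^sub>R (transpose T *v ones) = n *\<^sub>R ones" .
  \<comment> \<open>Moving \<open>T\<close> across the inner product evaluates
    \<open>c *\<^sub>R (transpose T *v ones)\<close> against \<open>ones\<close> a second time.
    Comparison with \<open>te\<close> and division by \<open>ones \<bullet> ones > 0\<close> give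
    \<open>c * c = n\<close>.\<close>
  have "(transpose T *v ones) \<bullet> ones = ones \<bullet> (T *v ones)"
    by (metis dot_lmul_matrix transpose_matrix_vector)
  then have "c * (c * (ones \<bullet> (ones :: real^'a))) = (c *\<^sub>R (transpose T *v ones)) \<bullet> ones"
    by (simp add: e)
  then have "c * c = n"
    unfolding te by (simp add: inner_ones_ones flip: mult.assoc)
  with te \<open>c \<noteq> 0\<close> have te': "transpose T *v ones = c *\<^sub>R ones"
    by (metis scaleR_left_imp_eq scaleR_scaleR)
  \<comment> \<open>On any \<open>x\<close>, both products equal
    \<open>(1 - \<alpha>) T x + \<alpha> c (e \<bullet> x) e\<close>: one side uses
    \<open>T e = c e\<close>, the other \<open>e \<bullet> T x = c (e \<bullet> x)\<close>.\<close>
  have "T ** equiangular_gram \<alpha> = equiangular_gram \<alpha> ** T"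
  proof (subst matrix_eq, intro allI)
    fix x
    have "ones \<bullet> (T *v x) = c * (ones \<bullet> x)"
      by (metis dot_lmul_matrix inner_scaleR_left te' transpose_matrix_vector)
    then show "(T ** equiangular_gram \<alpha>) *v x = (equiangular_gram \<alpha> ** T) *v x"
      by (simp add: matrix_vector_mul_assoc[symmetric] equiangular_gram_mult_vec
          matrix_vector_right_distrib matrix_vector_mult_scaleR e)
  qed
  then have "(T ** transpose T) ** T = equiangular_gram \<alpha> ** T"
    by (simp add: gram flip: matrix_mul_assoc)
  then have "T ** transpose T = equiangular_gram \<alpha>"
    using inv by (metis invertible_def matrix_mul_assoc matrix_mul_rid)
  then show ?thesis
    using inv by (simp add: equiangular_matrices_iff transpose_invertible)
qed

theorem theorem4p3:
  fixes S S' :: "real^'n^'n" and u :: "real^'n" and \<alpha> :: real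
  assumes "- 1 / (real CARD('n) - 1) < \<alpha>" and "\<alpha> < 1"
    and "S \<in> equiangular_matrices \<alpha>"
    and "u = (S - sqrt (1 + (real CARD('n) - 1) * \<alpha>) *\<^sub>R mat 1) *v ones"
    and "S' = householder u ** S"
  shows "(\<alpha> \<noteq> 0 \<longrightarrow> S' \<in> doubly_equiangular_matrices \<alpha>) \<and>
         (\<alpha> = 0 \<longrightarrow> S' \<in> doubly_orthogonal_matrices)"
proof -
  define c where "c = sqrt (1 + (real CARD('n) - 1) * \<alpha>)"
  have pos: "1 + (real CARD('n) - 1) * \<alpha> > 0"
  \<comment> \<open>In dimension one the lower bound on \<open>\<alpha>\<close> divides by zero, but
    the quantity is simply \<open>1\<close>. Otherwise the bound is multiplied by the positive
    \<open>real CARD('n) - 1\<close>.\<close>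
  proof (cases "CARD('n) = 1")
    case False
    then have "real CARD('n) - 1 > 0"
      using zero_less_card_finite[where 'a='n] by linarith
    then show ?thesis
      using assms(1) by (simp add: field_simps)
  qed simp
  have u: "u = S *v ones - c *\<^sub>R ones"
    by (simp add: assms(4) c_def matrix_vector_mult_diff_rdistrib flip: scaleR_matrix_vector_assoc)
  \<comment> \<open>Equality of norms for the reflection: the Gram matrix has eigenvalue
    \<open>c\<^sup>2\<close> at \<open>ones\<close>.\<close>
  have "(S *v ones) \<bullet> (S *v ones) = ones \<bullet> ((transpose S ** S) *v ones)"
    by (metis dot_lmul_matrix inner_commute matrix_vector_mul_assoc transpose_matrix_vector)
  also have "\<dots> = (c *\<^sub>R ones) \<bullet> (c *\<^sub>R ones :: real^'n)"
    using assms(3) pos by (simp add: equiangular_matrices_iff equiangular_gram_mult_ones c_def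
        flip: mult.assoc)
  finally have "householder u *v (S *v ones) = c *\<^sub>R ones"
    unfolding u by (intro householder_swap) (simp only: norm_eq)
  then have e: "S' *v ones = c *\<^sub>R ones"
    by (simp add: assms(5) flip: matrix_vector_mul_assoc)
  have S': "S' \<in> equiangular_matrices \<alpha>"
    using assms(3,5) by (simp add: orthogonal_mult_equiangular orthogonal_matrix_householder)
  have "c \<noteq> 0"
    using pos by (simp add: c_def)
  have "S' \<in> doubly_equiangular_matrices \<alpha>"
    using S' transpose_equiangular_if_eigenvector_ones[OF S' e \<open>c \<noteq> 0\<close>]
    by (simp add: doubly_equiangular_matrices_def)
  \<comment> \<open>At \<open>\<alpha> = 0\<close> the Gram matrix is the identity, which gives
    orthogonality; the eigenvector property is \<open>e\<close>.\<close>
  moreover have "S' \<in> doubly_orthogonal_matrices" if "\<alpha> = 0"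
  proof -
    have "orthogonal_matrix S'"
      using S' that by (simp add: equiangular_matrices_iff equiangular_gram_0 orthogonal_matrix)
    moreover have "(ones :: real^'n) \<noteq> 0"
      by (simp add: ones_def vec_eq_iff)
    ultimately show ?thesis
      using e by (auto simp: doubly_orthogonal_matrices_def is_eigenvector_def)
  qed
  ultimately show ?thesis
    by blast
qed

end
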